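(* Let $(\Omega,\mathcal{F},\mathbb{P})$ be a nonatomic probability space, let $\alpha\in(0,1)$ and let $S=(S_0,S_1)$ be an eligible asset. Then $S\text{-}\mathrm{VaR}_\alpha$ is comonotonic if and only if $S$ is risk-free.
   Context: $L^\infty=L^\infty(\Omega,\mathcal{F},\mathbb{P})$ is the space of (a.s.-equivalence classes of) essentially bounded real random variables, and $L^\infty_+=\{X\in L^\infty : X\ge 0 \text{ a.s.}\}$. An eligible asset is a pair $S=(S_0,S_1)\in(0,\infty)\times L^\infty_+$ with $S_1\ge\varepsilon$ a.s. for some constant $\varepsilon>0$; $S$ is risk-free if $S_1$ is (a.s.) constant. The risk measure $S\text{-}\mathrm{VaR}_\alpha:L^\infty\to\mathbb{R}$ is defined by $S\text{-}\mathrm{VaR}_\alpha(X)=\inf\{m\in\mathbb{R} : \mathbb{P}(X+\tfrac{m}{S_0}S_1<0)\leq\alpha\}$. Two random variables $X,Y\in L^\infty$ are comonotone if there is a $\mathbb{P}\otimes\mathbb{P}$-null set $N$ such that $(X(\omega)-X(\omega'))(Y(\omega)-Y(\omega'))\ge0$ for all $(\omega,\omega')\in(\Omega\times\Omega)\setminus N$. A functional $\rho:L^\infty\to\mathbb{R}$ is comonotonic if $\rho(X+Y)=\rho(X)+\rho(Y)$ for all comonotone $X,Y\in L^\infty$. *)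

theory Defs
  imports "HOL-Probability.Probability"
begin

definition nonatomic :: "'a measure \<Rightarrow> bool" where
  "nonatomic M \<longleftrightarrow>
     (\<forall>A\<in>sets M. emeasure M A > 0 \<longrightarrow>
        (\<exists>B\<in>sets M. B \<subseteq> A \<and> 0 < emeasure M B \<and> emeasure M B < emeasure M A))"

text \<open>
  Elements of \<open>L\<^sup>\<infinity>\<close> are handled through their representatives: measurable, essentially
  bounded functions. The notions below that take such functions depend only on their
  almost-sure equivalence classes; for the risk measure this is \<open>S_VaR_cong_AE\<close>.
\<close>

definition Linf :: "'a measure \<Rightarrow> ('a \<Rightarrow> real) set" where
  "Linf M = {X \<in> borel_measurable M. \<exists>C. AE \<omega> in M. \<bar>X \<omega>\<bar> \<le> C}"

definition Linf_plus :: "'a measure \<Rightarrow> ('a \<Rightarrow> real) set" where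
  "Linf_plus M = {X \<in> Linf M. AE \<omega> in M. 0 \<le> X \<omega>}"

definition eligible_asset :: "'a measure \<Rightarrow> real \<times> ('a \<Rightarrow> real) \<Rightarrow> bool" where
  "eligible_asset M S \<longleftrightarrow>
     fst S > 0 \<and> snd S \<in> Linf_plus M \<and> (\<exists>\<epsilon>>0. AE \<omega> in M. \<epsilon> \<le> snd S \<omega>)"

definition risk_free :: "'a measure \<Rightarrow> real \<times> ('a \<Rightarrow> real) \<Rightarrow> bool" where
  "risk_free M S \<longleftrightarrow> (\<exists>c. AE \<omega> in M. snd S \<omega> = c)"

definition S_VaR ::
  "'a measure \<Rightarrow> real \<times> ('a \<Rightarrow> real) \<Rightarrow> real \<Rightarrow> ('a \<Rightarrow> real) \<Rightarrow> real" where
  "S_VaR M S \<alpha> X =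
     Inf {m. measure M {\<omega> \<in> space M. X \<omega> + m / fst S * snd S \<omega> < 0} \<le> \<alpha>}"

definition comonotone :: "'a measure \<Rightarrow> ('a \<Rightarrow> real) \<Rightarrow> ('a \<Rightarrow> real) \<Rightarrow> bool" where
  "comonotone M X Y \<longleftrightarrow>
     (\<exists>N\<in>null_sets (M \<Otimes>\<^sub>M M). \<forall>(\<omega>, \<omega>')\<in>space M \<times> space M - N.
        (X \<omega> - X \<omega>') * (Y \<omega> - Y \<omega>') \<ge> 0)"

definition comonotonic :: "'a measure \<Rightarrow> (('a \<Rightarrow> real) \<Rightarrow> real) \<Rightarrow> bool" where
  "comonotonic M \<rho> \<longleftrightarrow>
     (\<forall>X\<in>Linf M. \<forall>Y\<in>Linf M. comonotone M X Y \<longrightarrow> \<rho> (\<lambda>\<omega>. X \<omega> + Y \<omega>) = \<rho> X + \<rho> Y)"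

lemma S_VaR_cong_AE:
  assumes "eligible_asset M S" "X \<in> Linf M" "Y \<in> Linf M" "AE \<omega> in M. X \<omega> = Y \<omega>"
  shows "S_VaR M S \<alpha> X = S_VaR M S \<alpha> Y"
proof -
  have [measurable]: "X \<in> borel_measurable M" "Y \<in> borel_measurable M"
      "snd S \<in> borel_measurable M"
    using assms by (auto simp: Linf_def Linf_plus_def eligible_asset_def)
  have "measure M {\<omega> \<in> space M. X \<omega> + m / fst S * snd S \<omega> < 0} =
      measure M {\<omega> \<in> space M. Y \<omega> + m / fst S * snd S \<omega> < 0}" for m
  proof (rule measure_eq_AE)
    show "AE \<omega> in M. \<omega> \<in> {\<omega> \<in> space M. X \<omega> + m / fst S * snd S \<omega> < 0} \<longleftrightarrow>
        \<omega> \<in> {\<omega> \<in> space M. Y \<omega> + m / fst S * snd S \<omega> < 0}"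
      using assms(4) by eventually_elim auto
  qed measurable
  then show ?thesis by (simp add: S_VaR_def)
qed

text \<open>
  \<open>Inf\<close> on the reals is unspecified for sets that are empty or unbounded below; neither
  case arises in \<open>S_VaR\<close>.
\<close>

lemma S_VaR_set:
  assumes "prob_space M" "0 < \<alpha>" "\<alpha> < 1" "eligible_asset M S" "X \<in> Linf M"
  defines "A \<equiv> {m. measure M {\<omega> \<in> space M. X \<omega> + m / fst S * snd S \<omega> < 0} \<le> \<alpha>}"
  shows "A \<noteq> {}" and "bdd_below A"
proof -
  interpret prob_space M by fact
  have [measurable]: "X \<in> borel_measurable M" "snd S \<in> borel_measurable M"
    using assms by (auto simp: Linf_def Linf_plus_def eligible_asset_def)
  obtain C where C: "AE \<omega> in M. \<bar>X \<omega>\<bar> \<le> C"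
    using assms by (auto simp: Linf_def)
  obtain e where e: "e > 0" "AE \<omega> in M. e \<le> snd S \<omega>" and S0: "fst S > 0"
    using assms by (auto simp: eligible_asset_def)
  define K where "K = (\<bar>C\<bar> + 1) / e"
  have K: "K > 0" "K * e = \<bar>C\<bar> + 1"
    using e by (auto simp: K_def field_simps)
  have dom: "AE \<omega> in M. \<bar>X \<omega>\<bar> < K * snd S \<omega>"
    using C e(2)
  proof eventually_elim
    case (elim \<omega>)
    have "K * e \<le> K * snd S \<omega>" using elim K by (intro mult_left_mono) auto
    with elim K show ?case by linarith
  qed
  have "prob {\<omega> \<in> space M. X \<omega> + (K * fst S) / fst S * snd S \<omega> < 0} = 0"
    using dom S0 by (subst prob_Collect_eq_0) (auto elim!: eventually_mono)
  with assms(2) have "K * fst S \<in> A" unfolding A_def mem_Collect_eq by linarith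
  then show "A \<noteq> {}" by blast
  have "- K * fst S \<le> m" if "m \<in> A" for m
  proof (rule ccontr)
    assume "\<not> - K * fst S \<le> m"
    then have m: "m / fst S \<le> - K" using S0 by (simp add: field_simps)
    have "AE \<omega> in M. X \<omega> + m / fst S * snd S \<omega> < 0"
      using dom e(2)
    proof eventually_elim
      case (elim \<omega>)
      have "m / fst S * snd S \<omega> \<le> - K * snd S \<omega>"
        using elim e m by (intro mult_right_mono) auto
      with elim show ?case by (auto simp: abs_less_iff)
    qed
    then have "prob {\<omega> \<in> space M. X \<omega> + m / fst S * snd S \<omega> < 0} = 1"
      by (subst prob_Collect_eq_1) auto
    with that assms(3) show False by (simp add: A_def)
  qed
  then show "bdd_below A" by (rule bdd_belowI)
qed

end

theory Submission
  imports Defs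
begin

text \<open>
  Let \<open>Q W\<close> be the infimum of the \<open>x\<close> with \<open>P(W > x) \<le> \<alpha>\<close>. Discounting by \<open>S\<^sub>1\<close> gives
  \<open>S-VaR X = S\<^sub>0 * Q (- X / S\<^sub>1)\<close>. If \<open>S\<^sub>1\<close> is constant, comonotonicity follows from that of \<open>Q\<close>:
  upper level sets of comonotone variables are nested up to null sets, so probabilities of
  their unions and intersections are maxima and minima.

  Conversely, constants are comonotone with everything, and \<open>- X / S\<^sub>1\<close> ranges over all of
  \<open>L\<^sup>\<infinity>\<close>. Hence with \<open>T = 1 / S\<^sub>1\<close> and \<open>t = Q T\<close> we get \<open>Q (W + T) = Q W + t\<close> for every \<open>W\<close>. Suppose
  \<open>T\<close> stays away from \<open>t\<close>, on one side, on a set of positive probability. Choose \<open>C\<close> inside it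
  and \<open>A\<close> disjoint from \<open>C\<close> with \<open>P A \<le> \<alpha> < P (A \<union> C)\<close>, and let \<open>W\<close> be very large on \<open>A\<close>, zero
  on \<open>C\<close> and very negative elsewhere. Then \<open>Q W = 0\<close>, while \<open>Q (W + T)\<close> is determined by the
  values of \<open>T\<close> on \<open>C\<close> and so differs from \<open>t\<close>.
\<close>

section \<open>Nonatomic measures\<close>

context finite_measure
begin

text \<open>Nonatomicity splits a set of positive mass into two pieces of positive mass, one of
  which has at most half of the total. Repeating this \<open>n\<close> times leaves mass at most
  \<open>measure M A * (1/2)^n\<close>.\<close>

lemma nonatomic_small_subset:
  assumes "nonatomic M" "A \<in> sets M" "0 < measure M A" "0 < e"
  obtains B where "B \<in> sets M" "B \<subseteq> A" "0 < measure M B" "measure M B \<le> e"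
proof -
  have ex: "\<exists>B\<in>sets M. B \<subseteq> A \<and> 0 < measure M B \<and> measure M B \<le> measure M A * (1/2)^n" for n
  proof (induction n)
    case 0
    then show ?case using assms by auto
  next
    case (Suc n)
    then obtain B where B: "B \<in> sets M" "B \<subseteq> A" "0 < measure M B"
        "measure M B \<le> measure M A * (1/2)^n" by auto
    then obtain B' where B': "B' \<in> sets M" "B' \<subseteq> B" "0 < measure M B'"
        "measure M B' < measure M B"
      using assms(1) unfolding nonatomic_def
      by (auto simp: emeasure_eq_measure ennreal_less_iff)
    have diff: "measure M (B - B') = measure M B - measure M B'"
      using B B' by (intro finite_measure_Diff) auto
    show ?case
    proof (cases "measure M B' \<le> measure M B / 2")
      case True
      then show ?thesis using B B' by (intro bexI[of _ B']) auto
    next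
      case False
      then show ?thesis using B B' diff by (intro bexI[of _ "B - B'"]) auto
    qed
  qed
  obtain n where n: "(1/2)^n < e / measure M A"
    using real_arch_pow_inv[of "e / measure M A" "1/2"] assms by auto
  then have "measure M A * (1/2)^n \<le> e"
    using assms by (simp add: field_simps)
  with ex[of n] that show thesis by (meson order_trans)
qed

text \<open>
  Sierpinski's theorem. The set is exhausted greedily: each step adds at least half of the
  largest mass that can still be added without exceeding \<open>c\<close>.
\<close>

lemma nonatomic_subset_of_measure:
  assumes na: "nonatomic M" and D: "D \<in> sets M" and c: "0 \<le> c" "c \<le> measure M D"
  obtains A where "A \<in> sets M" "A \<subseteq> D" "measure M A = c"
proof -
  \<comment> \<open>\<open>F A\<close> holds the sets that may still be added to \<open>A\<close>,
    and \<open>P\<close> is the invariant of the construction.\<close>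
  define F where "F A = {B \<in> sets M. B \<subseteq> D - A \<and> measure M A + measure M B \<le> c}" for A
  define P where "P A \<longleftrightarrow> A \<in> sets M \<and> A \<subseteq> D \<and> measure M A \<le> c" for A
  have step: "\<exists>A'. P A' \<and> A \<subseteq> A' \<and> (\<forall>B\<in>F A. measure M B \<le> 2 * (measure M A' - measure M A))"
    if A: "P A" for A
  proof -
    let ?s = "SUP B\<in>F A. measure M B"
    have bdd: "bdd_above (measure M ` F A)"
      by (rule bdd_aboveI[of _ "measure M (space M)"]) (auto intro: bounded_measure)
    have ne: "{} \<in> F A" using A by (auto simp: F_def P_def)
    have up: "measure M B \<le> ?s" if "B \<in> F A" for B
      using bdd that by (intro cSUP_upper)
    \<comment> \<open>The supremum need not be attained, so only half of it is claimed; if it is not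
      positive, \<open>{}\<close> serves.\<close>
    obtain B where B: "B \<in> F A" "?s \<le> 2 * measure M B"
    proof (cases "?s > 0")
      case True
      then have "?s / 2 < ?s" by simp
      then obtain B where "B \<in> F A" "?s / 2 < measure M B"
        using less_cSUP_iff[OF _ bdd, of "?s / 2"] ne by blast
      then show thesis using that[of B] by simp
    next
      case False
      then show thesis using that[of "{}"] ne by simp
    qed
    have "measure M (A \<union> B) = measure M A + measure M B"
      using A B by (intro finite_measure_Union) (auto simp: F_def P_def)
    then show ?thesis
      using A B up by (intro exI[of _ "A \<union> B"]) (auto simp: F_def P_def intro: order_trans)
  qed
  have "P {}" using c by (simp add: P_def)
  with step obtain f where f: "\<And>n. P (f n)" "\<And>n. f n \<subseteq> f (Suc n)"
      "\<And>n. \<forall>B\<in>F (f n). measure M B \<le> 2 * (measure M (f (Suc n)) - measure M (f n))"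
    using dependent_nat_choice[of "\<lambda>_. P" "\<lambda>_ A A'. A \<subseteq> A' \<and>
      (\<forall>B\<in>F A. measure M B \<le> 2 * (measure M A' - measure M A))"] by metis
  define A where "A = (\<Union>n. f n)"
  have A: "A \<in> sets M" "A \<subseteq> D" using f(1) by (auto simp: A_def P_def)
  have "incseq f" using f(2) by (rule incseq_SucI)
  then have lim: "(\<lambda>n. measure M (f n)) \<longlonglongrightarrow> measure M A"
    using f(1) unfolding A_def by (intro finite_Lim_measure_incseq) (auto simp: P_def)
  then have le: "measure M A \<le> c"
    using f(1) by (intro LIMSEQ_le_const2) (auto simp: P_def)
  have "measure M A = c"
  proof (rule ccontr)
    assume "measure M A \<noteq> c"
    with le have less: "measure M A < c" by simp
    moreover have "measure M (D - A) = measure M D - measure M A"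
      using A D by (intro finite_measure_Diff) auto
    ultimately have "0 < measure M (D - A)" "0 < c - measure M A"
      using c by auto
    then obtain B where B: "B \<in> sets M" "B \<subseteq> D - A" "0 < measure M B"
        "measure M B \<le> c - measure M A"
      using nonatomic_small_subset[OF na] A D by (metis sets.Diff)
    \<comment> \<open>\<open>B\<close> stays admissible at every stage, so twice each increment
      bounds its mass. The increments tend to 0 because the masses of \<open>f n\<close> converge,
      which forces \<open>B\<close> to have mass 0.\<close>
    have "B \<in> F (f n)" for n
    proof -
      have "measure M (f n) \<le> measure M A"
        using A by (intro finite_measure_mono) (auto simp: A_def)
      then show ?thesis using B by (auto simp: F_def A_def)
    qed
    then have "measure M B \<le> 2 * (measure M (f (Suc n)) - measure M (f n))" for n
      using f(3) by blast
    moreover have "(\<lambda>n. 2 * (measure M (f (Suc n)) - measure M (f n)))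
        \<longlonglongrightarrow> 2 * (measure M A - measure M A)"
      by (intro tendsto_intros lim LIMSEQ_Suc)
    ultimately have "measure M B \<le> 2 * (measure M A - measure M A)"
      by (intro LIMSEQ_le_const) auto
    with B show False by simp
  qed
  with A that show thesis by blast
qed

end

section \<open>Essentially bounded functions\<close>

lemma Linf_measurable: "X \<in> Linf M \<Longrightarrow> X \<in> borel_measurable M"
  by (simp add: Linf_def)

lemma Linf_const: "(\<lambda>_. c) \<in> Linf M"
  by (auto simp: Linf_def)

lemma Linf_add:
  assumes "X \<in> Linf M" "Y \<in> Linf M"
  shows "(\<lambda>\<omega>. X \<omega> + Y \<omega>) \<in> Linf M"
proof -
  obtain C D where "AE \<omega> in M. \<bar>X \<omega>\<bar> \<le> C" "AE \<omega> in M. \<bar>Y \<omega>\<bar> \<le> D"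
    using assms by (auto simp: Linf_def)
  then have "AE \<omega> in M. \<bar>X \<omega> + Y \<omega>\<bar> \<le> C + D"
    by eventually_elim linarith
  with assms show ?thesis by (auto simp: Linf_def)
qed

lemma Linf_mult:
  assumes "X \<in> Linf M" "Y \<in> Linf M"
  shows "(\<lambda>\<omega>. X \<omega> * Y \<omega>) \<in> Linf M"
proof -
  obtain C D where "AE \<omega> in M. \<bar>X \<omega>\<bar> \<le> C" "AE \<omega> in M. \<bar>Y \<omega>\<bar> \<le> D"
    using assms by (auto simp: Linf_def)
  then have "AE \<omega> in M. \<bar>X \<omega> * Y \<omega>\<bar> \<le> C * D"
    by eventually_elim (auto simp: abs_mult intro: mult_mono)
  with assms show ?thesis by (auto simp: Linf_def)
qed

lemma eligible_asset_Linf: "eligible_asset M S \<Longrightarrow> snd S \<in> Linf M"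
  by (simp add: eligible_asset_def Linf_plus_def)

lemma eligible_asset_AE_pos: "eligible_asset M S \<Longrightarrow> AE \<omega> in M. 0 < snd S \<omega>"
  unfolding eligible_asset_def by (auto elim!: eventually_mono)

lemma eligible_asset_inverse_Linf:
  assumes "eligible_asset M S"
  shows "(\<lambda>\<omega>. 1 / snd S \<omega>) \<in> Linf M"
proof -
  obtain e where e: "e > 0" "AE \<omega> in M. e \<le> snd S \<omega>"
    using assms by (auto simp: eligible_asset_def)
  from e(2) have "AE \<omega> in M. \<bar>1 / snd S \<omega>\<bar> \<le> 1 / e"
    by eventually_elim (use e(1) in \<open>auto simp: field_simps\<close>)
  with eligible_asset_Linf[OF assms] show ?thesis by (auto simp: Linf_def)
qed

lemma comonotone_const: "comonotone M X (\<lambda>_. c)"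
  unfolding comonotone_def by (rule bexI[of _ "{}"]) auto

text \<open>Each difference gains the factor \<open>k\<close>, so the product gains a square. Hence
  \<open>k\<close> may be negative, as it is when losses \<open>- X\<close> are discounted by a
  constant payoff.\<close>

lemma comonotone_scale:
  assumes "comonotone M X Y"
  shows "comonotone M (\<lambda>\<omega>. k * X \<omega>) (\<lambda>\<omega>. k * Y \<omega>)"
proof -
  have eq: "(k * a - k * b) * (k * c - k * d) = k\<^sup>2 * ((a - b) * (c - d))" for a b c d :: real
    by (simp add: power2_eq_square algebra_simps)
  have nonneg: "0 \<le> (k * a - k * b) * (k * c - k * d)"
    if "0 \<le> (a - b) * (c - d)" for a b c d :: real
    using that unfolding eq by (rule mult_nonneg_nonneg[OF zero_le_power2])
  from assms obtain N where N: "N \<in> null_sets (M \<Otimes>\<^sub>M M)"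
      "\<forall>(\<omega>, \<omega>')\<in>space M \<times> space M - N. (X \<omega> - X \<omega>') * (Y \<omega> - Y \<omega>') \<ge> 0"
    unfolding comonotone_def by blast
  show ?thesis
    unfolding comonotone_def
  proof (intro bexI[OF _ N(1)] ballI, clarify)
    fix \<omega> \<omega>' assume "\<omega> \<in> space M" "\<omega>' \<in> space M" "(\<omega>, \<omega>') \<notin> N"
    then have "(X \<omega> - X \<omega>') * (Y \<omega> - Y \<omega>') \<ge> 0" using N(2) by blast
    then show "(k * X \<omega> - k * X \<omega>') * (k * Y \<omega> - k * Y \<omega>') \<ge> 0" by (rule nonneg)
  qed
qed

section \<open>Upper quantiles\<close>

text \<open>For a probability measure this is the lower quantile of \<open>W\<close> at level 1 -
  \<alpha>; "upper" refers to the tail. The strict inequality makes the tail probability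
  right-continuous in \<open>x\<close>.\<close>

definition upper_quantile :: "'a measure \<Rightarrow> real \<Rightarrow> ('a \<Rightarrow> real) \<Rightarrow> real" where
  "upper_quantile M \<alpha> W = Inf {x. measure M {\<omega> \<in> space M. x < W \<omega>} \<le> \<alpha>}"

lemma upper_quantile_cong_AE:
  assumes [measurable]: "V \<in> borel_measurable M" "W \<in> borel_measurable M"
    and eq: "AE \<omega> in M. V \<omega> = W \<omega>"
  shows "upper_quantile M \<alpha> V = upper_quantile M \<alpha> W"
proof -
  have "measure M {\<omega> \<in> space M. x < V \<omega>} = measure M {\<omega> \<in> space M. x < W \<omega>}" for x
    by (rule measure_eq_AE) (use eq in \<open>auto elim!: eventually_mono\<close>)
  then show ?thesis by (simp add: upper_quantile_def)
qed

context prob_space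
begin

text \<open>The tail probability is nonincreasing and right-continuous in \<open>x\<close>, so the
  infimum is attained and the set under it is a closed half-line. Later quantile estimates work
  through this equivalence.\<close>

lemma upper_quantile_le_iff:
  assumes \<alpha>: "0 < \<alpha>" "\<alpha> < 1" and W: "W \<in> Linf M"
  shows "upper_quantile M \<alpha> W \<le> x \<longleftrightarrow> prob {\<omega> \<in> space M. x < W \<omega>} \<le> \<alpha>"
proof -
  have [measurable]: "W \<in> borel_measurable M" using W by (rule Linf_measurable)
  obtain C where C: "AE \<omega> in M. \<bar>W \<omega>\<bar> \<le> C" using W by (auto simp: Linf_def)
  define G where "G = {x. prob {\<omega> \<in> space M. x < W \<omega>} \<le> \<alpha>}"
  \<comment> \<open>The essential bound \<open>C\<close> shows that \<open>G\<close> is nonempty and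
    bounded below, so that its \<open>Inf\<close> is meaningful; here the bounds on \<alpha>
    enter.\<close>
  have "prob {\<omega> \<in> space M. C < W \<omega>} = 0"
    using C by (subst prob_Collect_eq_0) (auto elim!: eventually_mono)
  then have ne: "G \<noteq> {}" using \<alpha> by (auto simp: G_def intro!: exI[of _ C])
  have "- C \<le> y" if "y \<in> G" for y
  proof (rule ccontr)
    assume "\<not> - C \<le> y"
    then have "prob {\<omega> \<in> space M. y < W \<omega>} = 1"
      using C by (subst prob_Collect_eq_1) (auto elim!: eventually_mono)
    with that \<alpha> show False by (simp add: G_def)
  qed
  then have bdd: "bdd_below G" by (rule bdd_belowI)
  show ?thesis
  proof
    assume "prob {\<omega> \<in> space M. x < W \<omega>} \<le> \<alpha>"
    then have "x \<in> G" by (simp add: G_def)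
    then show "upper_quantile M \<alpha> W \<le> x"
      unfolding upper_quantile_def G_def[symmetric] using bdd by (rule cInf_lower)
  next
    assume le: "upper_quantile M \<alpha> W \<le> x"
    have up: "prob {\<omega> \<in> space M. z < W \<omega>} \<le> \<alpha>" if "x < z" for z
    proof -
      have "Inf G < z" using le that by (simp add: upper_quantile_def G_def)
      then obtain y where "y \<in> G" "y < z" using cInf_lessD[OF ne] by blast
      moreover from this have "prob {\<omega> \<in> space M. z < W \<omega>} \<le> prob {\<omega> \<in> space M. y < W \<omega>}"
        by (intro finite_measure_mono) auto
      ultimately show ?thesis by (simp add: G_def)
    qed
    \<comment> \<open>Right-continuity: the tail events at thresholds x + 1/(n+1) increase to the
      one at \<open>x\<close>, and \<open>up\<close> bounds the probability of each.\<close>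
    have "(\<lambda>n. prob {\<omega> \<in> space M. x + 1 / real (Suc n) < W \<omega>})
        \<longlonglongrightarrow> prob (\<Union>n. {\<omega> \<in> space M. x + 1 / real (Suc n) < W \<omega>})"
    proof (intro finite_Lim_measure_incseq incseq_SucI subsetI)
      fix n \<omega> assume "\<omega> \<in> {\<omega> \<in> space M. x + 1 / real (Suc n) < W \<omega>}"
      moreover have "1 / real (Suc (Suc n)) \<le> 1 / real (Suc n)"
        by (simp add: frac_le)
      ultimately show "\<omega> \<in> {\<omega> \<in> space M. x + 1 / real (Suc (Suc n)) < W \<omega>}"
        by auto
    qed auto
    also have "(\<Union>n. {\<omega> \<in> space M. x + 1 / real (Suc n) < W \<omega>}) = {\<omega> \<in> space M. x < W \<omega>}"
    proof (intro equalityI subsetI)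
      fix \<omega> assume "\<omega> \<in> {\<omega> \<in> space M. x < W \<omega>}"
      moreover then obtain n where "1 / real (Suc n) < W \<omega> - x"
        using nat_approx_posE[of "W \<omega> - x"] by auto
      ultimately show "\<omega> \<in> (\<Union>n. {\<omega> \<in> space M. x + 1 / real (Suc n) < W \<omega>})"
        by (auto intro!: exI[of _ n])
    next
      fix \<omega> assume "\<omega> \<in> (\<Union>n. {\<omega> \<in> space M. x + 1 / real (Suc n) < W \<omega>})"
      then obtain n where "\<omega> \<in> space M" "x + 1 / real (Suc n) < W \<omega>" by auto
      moreover have "0 < 1 / real (Suc n)" by simp
      ultimately show "\<omega> \<in> {\<omega> \<in> space M. x < W \<omega>}" unfolding mem_Collect_eq by linarith
    qed
    finally show "prob {\<omega> \<in> space M. x < W \<omega>} \<le> \<alpha>"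
      by (rule LIMSEQ_le_const2) (auto intro!: up)
  qed
qed

section \<open>Comonotone additivity of quantiles\<close>

lemma comonotone_level_sets:
  fixes u v :: real
  assumes co: "comonotone M U V"
    and [measurable]: "U \<in> borel_measurable M" "V \<in> borel_measurable M"
  defines "A \<equiv> {\<omega> \<in> space M. u < U \<omega>}" and "B \<equiv> {\<omega> \<in> space M. v < V \<omega>}"
  shows "prob (A - B) = 0 \<or> prob (B - A) = 0"
proof -
  have [measurable]: "A \<in> sets M" "B \<in> sets M" by (simp_all add: A_def B_def)
  obtain N where N: "N \<in> null_sets (M \<Otimes>\<^sub>M M)"
      "\<And>\<omega> \<omega>'. \<omega> \<in> space M \<Longrightarrow> \<omega>' \<in> space M \<Longrightarrow> (\<omega>, \<omega>') \<notin> N \<Longrightarrow>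
        (U \<omega> - U \<omega>') * (V \<omega> - V \<omega>') \<ge> 0"
    using co unfolding comonotone_def by blast
  \<comment> \<open>On this rectangle \<open>U\<close> strictly decreases and \<open>V\<close>
    strictly increases from the first point to the second, so comonotonicity fails there. A null
    rectangle has a null side.\<close>
  have "(A - B) \<times> (B - A) \<subseteq> N"
  proof clarify
    fix \<omega> \<omega>' assume *: "\<omega> \<in> A" "\<omega> \<notin> B" "\<omega>' \<in> B" "\<omega>' \<notin> A"
    then have "(U \<omega> - U \<omega>') * (V \<omega> - V \<omega>') < 0"
      by (auto simp: A_def B_def intro!: mult_pos_neg)
    with N(2)[of \<omega> \<omega>'] * show "(\<omega>, \<omega>') \<in> N"
      by (force simp: A_def B_def)
  qed
  then have "emeasure (M \<Otimes>\<^sub>M M) ((A - B) \<times> (B - A)) = 0"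
    using N(1) by (metis emeasure_mono le_zero_eq null_setsD1 null_setsD2)
  then have "emeasure M (A - B) * emeasure M (B - A) = 0"
    by (subst (asm) emeasure_pair_measure_Times) auto
  then show ?thesis by (auto simp: emeasure_eq_measure)
qed

lemma upper_quantile_add_comonotone:
  assumes \<alpha>: "0 < \<alpha>" "\<alpha> < 1" and U: "U \<in> Linf M" and V: "V \<in> Linf M"
    and co: "comonotone M U V"
  shows "upper_quantile M \<alpha> (\<lambda>\<omega>. U \<omega> + V \<omega>) = upper_quantile M \<alpha> U + upper_quantile M \<alpha> V"
    (is "?q = ?u + ?v")
proof (rule antisym)
  note [measurable] = Linf_measurable[OF U] Linf_measurable[OF V]
  note le_iff = upper_quantile_le_iff[OF \<alpha>]
  note UV = Linf_add[OF U V]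
  have level: "prob (A - B) = 0 \<or> prob (B - A) = 0"
    if "A = {\<omega> \<in> space M. u < U \<omega>}" "B = {\<omega> \<in> space M. v < V \<omega>}" for A B u v
    unfolding that by (intro comonotone_level_sets[OF co]) auto
  show "?q \<le> ?u + ?v"
  proof -
    \<comment> \<open>At the quantiles themselves both tails have mass at most \<alpha>. Being
      nested up to a null set, so does their union, which contains the tail of the sum.\<close>
    define A where "A = {\<omega> \<in> space M. ?u < U \<omega>}"
    define B where "B = {\<omega> \<in> space M. ?v < V \<omega>}"
    have [measurable]: "A \<in> sets M" "B \<in> sets M" by (simp_all add: A_def B_def)
    have "prob A \<le> \<alpha>" "prob B \<le> \<alpha>"
      using le_iff[OF U, of ?u] le_iff[OF V, of ?v] by (auto simp: A_def B_def)
    moreover have "prob (A \<union> B) = prob A + prob (B - A)" "prob (B \<union> A) = prob B + prob (A - B)"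
      by (intro finite_measure_Union'; simp)+
    ultimately have "prob (A \<union> B) \<le> \<alpha>"
      using level[OF A_def B_def] by (auto simp: Un_commute)
    moreover have "prob {\<omega> \<in> space M. ?u + ?v < U \<omega> + V \<omega>} \<le> prob (A \<union> B)"
      by (intro finite_measure_mono) (auto simp: A_def B_def)
    ultimately show ?thesis by (simp add: le_iff[OF UV])
  qed
  show "?u + ?v \<le> ?q"
  proof (rule field_le_epsilon)
    fix e :: real assume e: "0 < e"
    \<comment> \<open>Strictly below the quantiles both tails have mass above \<alpha>, hence so
      does their intersection; the two gaps of \<open>e / 2\<close> add up to
      \<open>e\<close>.\<close>
    define A where "A = {\<omega> \<in> space M. ?u - e / 2 < U \<omega>}"
    define B where "B = {\<omega> \<in> space M. ?v - e / 2 < V \<omega>}"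
    have [measurable]: "A \<in> sets M" "B \<in> sets M" by (simp_all add: A_def B_def)
    have "\<alpha> < prob A" "\<alpha> < prob B"
      using le_iff[OF U, of "?u - e / 2"] le_iff[OF V, of "?v - e / 2"] e
      by (auto simp: A_def B_def)
    moreover have "prob (A - B) = prob A - prob (A \<inter> B)" "prob (B - A) = prob B - prob (B \<inter> A)"
      by (intro finite_measure_Diff'; simp)+
    ultimately have "\<alpha> < prob (A \<inter> B)"
      using level[OF A_def B_def] by (auto simp: Int_commute)
    moreover have "prob (A \<inter> B) \<le> prob {\<omega> \<in> space M. ?u + ?v - e < U \<omega> + V \<omega>}"
      by (intro finite_measure_mono) (auto simp: A_def B_def)
    ultimately have "\<not> ?q \<le> ?u + ?v - e" by (simp add: le_iff[OF UV])
    then show "?u + ?v \<le> ?q + e" by simp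
  qed
qed

section \<open>Discounting by the eligible asset\<close>

lemma S_VaR_eq_upper_quantile:
  assumes \<alpha>: "0 < \<alpha>" "\<alpha> < 1" and S: "eligible_asset M S" and X: "X \<in> Linf M"
  shows "S_VaR M S \<alpha> X = fst S * upper_quantile M \<alpha> (\<lambda>\<omega>. - X \<omega> / snd S \<omega>)"
proof -
  let ?W = "\<lambda>\<omega>. - X \<omega> / snd S \<omega>"
  note [measurable] = Linf_measurable[OF X] Linf_measurable[OF eligible_asset_Linf[OF S]]
  have S0: "0 < fst S" using S by (simp add: eligible_asset_def)
  have W: "?W \<in> Linf M"
    using Linf_mult[OF Linf_const Linf_mult[OF X eligible_asset_inverse_Linf[OF S]], of "-1"]
    by simp
  have "prob {\<omega> \<in> space M. X \<omega> + m / fst S * snd S \<omega> < 0} =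
      prob {\<omega> \<in> space M. m / fst S < ?W \<omega>}" for m
  proof (rule measure_eq_AE)
    show "AE \<omega> in M. \<omega> \<in> {\<omega> \<in> space M. X \<omega> + m / fst S * snd S \<omega> < 0} \<longleftrightarrow>
        \<omega> \<in> {\<omega> \<in> space M. m / fst S < ?W \<omega>}"
      using eligible_asset_AE_pos[OF S]
    proof eventually_elim
      case (elim \<omega>)
      then have "m / fst S < ?W \<omega> \<longleftrightarrow> m / fst S * snd S \<omega> < - X \<omega>"
        by (intro pos_less_divide_eq)
      also have "\<dots> \<longleftrightarrow> X \<omega> + m / fst S * snd S \<omega> < 0" by linarith
      finally show ?case by simp
    qed
  qed measurable
  then have "prob {\<omega> \<in> space M. X \<omega> + m / fst S * snd S \<omega> < 0} \<le> \<alpha> \<longleftrightarrow>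
      upper_quantile M \<alpha> ?W \<le> m / fst S" for m
    by (simp only: upper_quantile_le_iff[OF \<alpha> W])
  then have "prob {\<omega> \<in> space M. X \<omega> + m / fst S * snd S \<omega> < 0} \<le> \<alpha> \<longleftrightarrow>
      fst S * upper_quantile M \<alpha> ?W \<le> m" for m
    by (simp only: pos_le_divide_eq[OF S0] mult.commute)
  then have "S_VaR M S \<alpha> X = Inf {fst S * upper_quantile M \<alpha> ?W..}"
    by (simp add: S_VaR_def atLeast_def)
  then show ?thesis by simp
qed

lemma comonotonic_S_VaR_if_risk_free:
  assumes \<alpha>: "0 < \<alpha>" "\<alpha> < 1" and S: "eligible_asset M S" and "risk_free M S"
  shows "comonotonic M (S_VaR M S \<alpha>)"
  unfolding comonotonic_def
proof (intro ballI impI)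
  fix X Y assume X: "X \<in> Linf M" and Y: "Y \<in> Linf M" and co: "comonotone M X Y"
  obtain c where c: "AE \<omega> in M. snd S \<omega> = c"
    using assms(4) by (auto simp: risk_free_def)
  note [measurable] = Linf_measurable[OF eligible_asset_Linf[OF S]]
  \<comment> \<open>Writing the discounted loss as a fixed multiple of \<open>Z\<close> makes it
    additive in \<open>Z\<close> and lets \<open>comonotone_scale\<close> apply.\<close>
  have eq: "S_VaR M S \<alpha> Z = fst S * upper_quantile M \<alpha> (\<lambda>\<omega>. - (1 / c) * Z \<omega>)"
    if Z: "Z \<in> Linf M" for Z
  proof -
    note [measurable] = Linf_measurable[OF Z]
    have "upper_quantile M \<alpha> (\<lambda>\<omega>. - Z \<omega> / snd S \<omega>) = upper_quantile M \<alpha> (\<lambda>\<omega>. - (1 / c) * Z \<omega>)"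
      by (rule upper_quantile_cong_AE) (use c in \<open>auto elim!: eventually_mono\<close>)
    then show ?thesis using S_VaR_eq_upper_quantile[OF \<alpha> S Z] by simp
  qed
  show "S_VaR M S \<alpha> (\<lambda>\<omega>. X \<omega> + Y \<omega>) = S_VaR M S \<alpha> X + S_VaR M S \<alpha> Y"
    unfolding eq[OF X] eq[OF Y] eq[OF Linf_add[OF X Y]] distrib_left
      upper_quantile_add_comonotone[OF \<alpha> Linf_mult[OF Linf_const X] Linf_mult[OF Linf_const Y]
        comonotone_scale[OF co]] ..
qed

lemma upper_quantile_add_if_comonotonic:
  assumes \<alpha>: "0 < \<alpha>" "\<alpha> < 1" and S: "eligible_asset M S"
    and co: "comonotonic M (S_VaR M S \<alpha>)" and W: "W \<in> Linf M"
  defines "T \<equiv> \<lambda>\<omega>. 1 / snd S \<omega>"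
  shows "upper_quantile M \<alpha> (\<lambda>\<omega>. W \<omega> + T \<omega>) = upper_quantile M \<alpha> W + upper_quantile M \<alpha> T"
proof -
  \<comment> \<open>These positions are chosen so that their discounted losses are \<open>W\<close>
    and \<open>T\<close>; the second is constant, hence comonotone with the first.\<close>
  let ?X = "\<lambda>\<omega>. - 1 * (W \<omega> * snd S \<omega>)" and ?Y = "\<lambda>_. - 1 :: real"
  note [measurable] = Linf_measurable[OF eligible_asset_Linf[OF S]] Linf_measurable[OF W]
  have X: "?X \<in> Linf M" and Y: "?Y \<in> Linf M"
    by (intro Linf_mult Linf_const W eligible_asset_Linf S)+
  have "S_VaR M S \<alpha> (\<lambda>\<omega>. ?X \<omega> + ?Y \<omega>) = S_VaR M S \<alpha> ?X + S_VaR M S \<alpha> ?Y"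
    using co X Y comonotone_const unfolding comonotonic_def by blast
  moreover have "fst S > 0" using S by (simp add: eligible_asset_def)
  ultimately have "upper_quantile M \<alpha> (\<lambda>\<omega>. - (?X \<omega> + ?Y \<omega>) / snd S \<omega>) =
      upper_quantile M \<alpha> (\<lambda>\<omega>. - ?X \<omega> / snd S \<omega>) + upper_quantile M \<alpha> (\<lambda>\<omega>. - ?Y \<omega> / snd S \<omega>)"
    unfolding S_VaR_eq_upper_quantile[OF \<alpha> S X] S_VaR_eq_upper_quantile[OF \<alpha> S Y]
      S_VaR_eq_upper_quantile[OF \<alpha> S Linf_add[OF X Y]] distrib_left[symmetric]
    by simp
  moreover have "upper_quantile M \<alpha> (\<lambda>\<omega>. - (?X \<omega> + ?Y \<omega>) / snd S \<omega>) =
      upper_quantile M \<alpha> (\<lambda>\<omega>. W \<omega> + T \<omega>)"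
    unfolding T_def
    by (rule upper_quantile_cong_AE)
       (use eligible_asset_AE_pos[OF S] in \<open>auto elim!: eventually_mono simp: field_simps\<close>)
  moreover have "upper_quantile M \<alpha> (\<lambda>\<omega>. - ?X \<omega> / snd S \<omega>) = upper_quantile M \<alpha> W"
    by (rule upper_quantile_cong_AE)
       (use eligible_asset_AE_pos[OF S] in \<open>auto elim!: eventually_mono\<close>)
  ultimately show ?thesis by (simp add: T_def)
qed

section \<open>Test variables for the converse\<close>

lemma nonatomic_straddle:
  assumes na: "nonatomic M" and \<alpha>: "0 < \<alpha>" "\<alpha> < 1" and D: "D \<in> sets M" "0 < prob D"
  obtains A C where "A \<in> sets M" "C \<in> sets M" "C \<subseteq> D" "A \<inter> C = {}"
    "prob A \<le> \<alpha>" "\<alpha> < prob (A \<union> C)"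
proof -
  \<comment> \<open>\<alpha> is to be the midpoint between the masses of \<open>A\<close> and
    \<open>A \<union> C\<close>. The bound by \<alpha> keeps \<alpha> - c/2 nonnegative, and the
    bound by 1 - \<alpha> leaves room for \<open>A\<close> outside \<open>C\<close>.\<close>
  define c where "c = min (prob D) (min \<alpha> (1 - \<alpha>))"
  have c: "0 < c" "c \<le> prob D" "c \<le> \<alpha>" "c \<le> 1 - \<alpha>"
    using \<alpha> D by (auto simp: c_def)
  obtain C where C: "C \<in> sets M" "C \<subseteq> D" "prob C = c"
    using nonatomic_subset_of_measure[OF na D(1), of c] c by auto
  have "\<alpha> - c / 2 \<le> prob (space M - C)"
    using c C by (simp add: prob_compl)
  then obtain A where A: "A \<in> sets M" "A \<subseteq> space M - C" "prob A = \<alpha> - c / 2"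
    using nonatomic_subset_of_measure[OF na, of "space M - C" "\<alpha> - c / 2"] c C by auto
  have disj: "A \<inter> C = {}" using A by auto
  then have "prob (A \<union> C) = \<alpha> + c / 2"
    using finite_measure_Union[OF A(1) C(1)] A C by simp
  with A C c disj that show thesis by auto
qed

lemma AE_eq_if_upper_quantile_translation:
  assumes na: "nonatomic M" and \<alpha>: "0 < \<alpha>" "\<alpha> < 1" and T: "T \<in> Linf M"
    and add: "\<And>W. W \<in> Linf M \<Longrightarrow>
      upper_quantile M \<alpha> (\<lambda>\<omega>. W \<omega> + T \<omega>) = upper_quantile M \<alpha> W + upper_quantile M \<alpha> T"
  shows "AE \<omega> in M. T \<omega> = upper_quantile M \<alpha> T"
proof -
  let ?t = "upper_quantile M \<alpha> T"
  note [measurable] = Linf_measurable[OF T]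
  note le_iff = upper_quantile_le_iff[OF \<alpha>]
  obtain b where b: "AE \<omega> in M. \<bar>T \<omega>\<bar> \<le> b" using T by (auto simp: Linf_def)
  have test: "\<exists>A C W. A \<in> sets M \<and> C \<in> sets M \<and> C \<subseteq> D \<and> prob A \<le> \<alpha> \<and> \<alpha> < prob (A \<union> C) \<and>
      W \<in> Linf M \<and> upper_quantile M \<alpha> (\<lambda>\<omega>. W \<omega> + T \<omega>) = ?t \<and>
      (\<forall>\<omega>. W \<omega> = (if \<omega> \<in> A then K else if \<omega> \<in> C then 0 else - K))"
    if D: "D \<in> sets M" "0 < prob D" and K: "0 \<le> K" for D K
  proof -
    obtain A C where AC: "A \<in> sets M" "C \<in> sets M" "C \<subseteq> D" "A \<inter> C = {}"
        "prob A \<le> \<alpha>" "\<alpha> < prob (A \<union> C)"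
      using nonatomic_straddle[OF na \<alpha> D] by blast
    note [measurable] = AC(1,2)
    define W where "W \<omega> = (if \<omega> \<in> A then K else if \<omega> \<in> C then 0 else - K)" for \<omega>
    have "W \<in> borel_measurable M" unfolding W_def by measurable
    moreover have "AE \<omega> in M. \<bar>W \<omega>\<bar> \<le> K" using K by (simp add: W_def)
    ultimately have W: "W \<in> Linf M" by (auto simp: Linf_def)
    note [measurable] = Linf_measurable[OF W]
    \<comment> \<open>The tail of \<open>W\<close> above 0 lies in \<open>A\<close>, of mass at most
      \<alpha>, while every tail above a negative level contains \<open>A \<union> C\<close>, of
      mass greater than \<alpha>.\<close>
    have "upper_quantile M \<alpha> W = 0"
    proof (rule antisym)
      have "prob {\<omega> \<in> space M. 0 < W \<omega>} \<le> prob A"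
        using K by (intro finite_measure_mono) (auto simp: W_def split: if_splits)
      with AC show "upper_quantile M \<alpha> W \<le> 0" by (simp add: le_iff[OF W])
      show "0 \<le> upper_quantile M \<alpha> W"
      proof (rule dense_le)
        fix x :: real assume "x < 0"
        then have "prob (A \<union> C) \<le> prob {\<omega> \<in> space M. x < W \<omega>}"
          using K sets.sets_into_space[OF AC(1)] sets.sets_into_space[OF AC(2)]
          by (intro finite_measure_mono) (auto simp: W_def)
        with AC have "\<not> upper_quantile M \<alpha> W \<le> x" by (simp add: le_iff[OF W])
        then show "x \<le> upper_quantile M \<alpha> W" by simp
      qed
    qed
    with add[OF W] have "upper_quantile M \<alpha> (\<lambda>\<omega>. W \<omega> + T \<omega>) = ?t" by simp
    with AC W W_def show ?thesis by blast
  qed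
  have low: "AE \<omega> in M. ?t - d < T \<omega>" if d: "0 < d" for d
  proof (rule ccontr)
    \<comment> \<open>\<open>?K\<close> is so large that outside \<open>A \<union> C\<close> almost
      surely W + T \<le> -|t| - d \<le> t - d. With the bound on \<open>C\<close>, only
      \<open>A\<close> can exceed t - d, so the quantile would drop to t - d.\<close>
    let ?D = "{\<omega> \<in> space M. T \<omega> \<le> ?t - d}" and ?K = "\<bar>b\<bar> + \<bar>?t\<bar> + d"
    assume "\<not> (AE \<omega> in M. ?t - d < T \<omega>)"
    then have "prob ?D \<noteq> 0" by (subst prob_Collect_eq_0) (auto simp: not_le)
    then have "0 < prob ?D" by (simp add: zero_less_measure_iff)
    then obtain A C W where AC: "A \<in> sets M" "C \<in> sets M" "C \<subseteq> ?D" "prob A \<le> \<alpha>"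
        and W: "W \<in> Linf M" "upper_quantile M \<alpha> (\<lambda>\<omega>. W \<omega> + T \<omega>) = ?t"
        "\<And>\<omega>. W \<omega> = (if \<omega> \<in> A then ?K else if \<omega> \<in> C then 0 else - ?K)"
      using test[of ?D ?K] d by auto
    note [measurable] = Linf_measurable[OF W(1)]
    have "AE \<omega> in M. \<omega> \<in> {\<omega> \<in> space M. ?t - d < W \<omega> + T \<omega>} \<longrightarrow> \<omega> \<in> A"
      using b
    proof eventually_elim
      case (elim \<omega>)
      have "W \<omega> + T \<omega> \<le> ?t - d" if "\<omega> \<notin> A"
      proof (cases "\<omega> \<in> C")
        case True
        then have "W \<omega> = 0" "T \<omega> \<le> ?t - d" using that AC(3) by (auto simp: W(3))
        then show ?thesis by simp
      next
        case False
        then have "W \<omega> = - ?K" using that by (simp add: W(3))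
        with elim show ?thesis by linarith
      qed
      then show ?case by fastforce
    qed
    then have "prob {\<omega> \<in> space M. ?t - d < W \<omega> + T \<omega>} \<le> prob A"
      using AC by (intro finite_measure_mono_AE) auto
    with AC have "upper_quantile M \<alpha> (\<lambda>\<omega>. W \<omega> + T \<omega>) \<le> ?t - d"
      by (simp add: le_iff[OF Linf_add[OF W(1) T]])
    with W d show False by simp
  qed
  have high: "AE \<omega> in M. T \<omega> < ?t + d" if d: "0 < d" for d
  proof (rule ccontr)
    \<comment> \<open>Here \<open>?K\<close> ensures that on \<open>A\<close> almost surely W + T
      \<ge> |t| + d > t. Since \<open>T\<close> exceeds \<open>t\<close> on \<open>C\<close> too,
      the tail above \<open>t\<close> has mass greater than \<alpha>.\<close>
    let ?D = "{\<omega> \<in> space M. ?t + d \<le> T \<omega>}" and ?K = "\<bar>b\<bar> + \<bar>?t\<bar> + d"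
    assume "\<not> (AE \<omega> in M. T \<omega> < ?t + d)"
    then have "prob ?D \<noteq> 0" by (subst prob_Collect_eq_0) (auto simp: not_le)
    then have "0 < prob ?D" by (simp add: zero_less_measure_iff)
    then obtain A C W where AC: "A \<in> sets M" "C \<in> sets M" "C \<subseteq> ?D" "\<alpha> < prob (A \<union> C)"
        and W: "W \<in> Linf M" "upper_quantile M \<alpha> (\<lambda>\<omega>. W \<omega> + T \<omega>) = ?t"
        "\<And>\<omega>. W \<omega> = (if \<omega> \<in> A then ?K else if \<omega> \<in> C then 0 else - ?K)"
      using test[of ?D ?K] d by auto
    note [measurable] = Linf_measurable[OF W(1)]
    have "AE \<omega> in M. \<omega> \<in> A \<union> C \<longrightarrow> \<omega> \<in> {\<omega> \<in> space M. ?t < W \<omega> + T \<omega>}"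
      using b AE_space
    proof eventually_elim
      case (elim \<omega>)
      show ?case
      proof
        assume *: "\<omega> \<in> A \<union> C"
        show "\<omega> \<in> {\<omega> \<in> space M. ?t < W \<omega> + T \<omega>}"
        proof (cases "\<omega> \<in> A")
          case True
          then have "W \<omega> = ?K" by (simp add: W(3))
          with elim d show ?thesis by auto
        next
          case False
          with * have "\<omega> \<in> C" by simp
          with False have "W \<omega> = 0" "?t + d \<le> T \<omega>" using AC(3) by (auto simp: W(3))
          with elim d show ?thesis by auto
        qed
      qed
    qed
    then have "prob (A \<union> C) \<le> prob {\<omega> \<in> space M. ?t < W \<omega> + T \<omega>}"
      by (intro finite_measure_mono_AE) auto
    with AC have "\<not> upper_quantile M \<alpha> (\<lambda>\<omega>. W \<omega> + T \<omega>) \<le> ?t"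
      by (simp add: le_iff[OF Linf_add[OF W(1) T]])
    with W show False by simp
  qed
  \<comment> \<open>Restricting \<open>d\<close> to the countably many values 1/(n+1) allows the
    exceptional null sets to be united.\<close>
  have "AE \<omega> in M. \<forall>n. ?t - 1 / real (Suc n) < T \<omega> \<and> T \<omega> < ?t + 1 / real (Suc n)"
    by (subst AE_all_countable) (intro allI AE_conjI low high; simp)
  then show ?thesis
  proof eventually_elim
    case (elim \<omega>)
    show ?case
    proof (rule ccontr)
      assume "T \<omega> \<noteq> ?t"
      then obtain n where "1 / real (Suc n) < \<bar>T \<omega> - ?t\<bar>"
        using nat_approx_posE[of "\<bar>T \<omega> - ?t\<bar>"] by auto
      with elim[rule_format, of n] show False by linarith
    qed
  qed
qed

lemma risk_free_if_comonotonic_S_VaR: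
  assumes "nonatomic M" "0 < \<alpha>" "\<alpha> < 1" and S: "eligible_asset M S"
    and "comonotonic M (S_VaR M S \<alpha>)"
  shows "risk_free M S"
proof -
  let ?T = "\<lambda>\<omega>. 1 / snd S \<omega>"
  have "AE \<omega> in M. ?T \<omega> = upper_quantile M \<alpha> ?T"
    using assms by (intro AE_eq_if_upper_quantile_translation upper_quantile_add_if_comonotonic
      eligible_asset_inverse_Linf)
  \<comment> \<open>Inversion is pointwise: 1/(1/s) = s for every real s, including 0 by the
    convention 1/0 = 0.\<close>
  then have "AE \<omega> in M. snd S \<omega> = 1 / upper_quantile M \<alpha> ?T"
    by eventually_elim (metis div_by_1 divide_divide_eq_right mult_1)
  then show ?thesis by (auto simp: risk_free_def)
qed

end

theorem proposition3p4:
  fixes M :: "'a measure" and \<alpha> :: real and S :: "real \<times> ('a \<Rightarrow> real)"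
  assumes "prob_space M" and "nonatomic M"
    and "0 < \<alpha>" and "\<alpha> < 1"
    and "eligible_asset M S"
  shows "comonotonic M (S_VaR M S \<alpha>) \<longleftrightarrow> risk_free M S"
  using prob_space.comonotonic_S_VaR_if_risk_free[OF assms(1,3,4,5)]
    prob_space.risk_free_if_comonotonic_S_VaR[OF assms] by blast

end
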